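(* Consider the one-dimensional balance law $q_t+f(q)_x=S(q,x)$ with $q$ taking values in $\mathbb{R}^N$, with $f$ differentiable and with $S(\cdot,x)$ linear in $q$ for each $x$. Let $\tilde q=\tilde q(x)$ be a given differentiable time-independent solution, that is, $f(\tilde q)_x=S(\tilde q,x)$, and set $\tilde q_j=\tilde q(x_j)$. Let $q^n_j$ ($j\in\mathbb{Z}$, $n\ge 0$) be computed by the fully discrete unstaggered central (Kurganov–Tadmor type) scheme with the Deviation method, built on $\tilde q$ and described in the context. Then the scheme is well-balanced: if the initial data satisfy $q^0_j=\tilde q_j$ for all $j$, then $q^n_j=\tilde q_j$ for all $j$ and all $n\ge 0$.
   Context: Grid. $x_j$ are the centers of uniform cells $C_j=[x_{j-\frac12},x_{j+\frac12}]$, $j\in\mathbb{Z}$, of width $\Delta x>0$. At each step $t^{n+1}=t^n+\Delta t$ with $\Delta t>0$ (possibly depending on $n$), and $\lambda=\Delta t/\Delta x$. The parameter $\theta\in[1,2]$ is fixed. The minmod function is $\mathrm{minmod}(a,b,c)=\mathrm{sign}(a)\min\{|a|,|b|,|c|\}$ if $\mathrm{sign}(a)=\mathrm{sign}(b)=\mathrm{sign}(c)$, and $0$ otherwise. It is applied componentwise to vectors. Deviation. $(\Delta q)^n_j=q^n_j-\tilde q_j$. The scheme computes $(\Delta q)^{n+1}_j$ from $(\Delta q)^n_j$ and then sets $q^{n+1}_j=(\Delta q)^{n+1}_j+\tilde q_j$. One step from $t^n$ to $t^{n+1}$ is as follows. (1) Reconstruction. The slopes are $$((\Delta q)_x)^n_j=\mathrm{minmod}\Big[\theta\tfrac{(\Delta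 q)^n_{j+1}-(\Delta q)^n_j}{\Delta x},\ \tfrac{(\Delta q)^n_{j+1}-(\Delta q)^n_{j-1}}{2\Delta x},\ \theta\tfrac{(\Delta q)^n_j-(\Delta q)^n_{j-1}}{\Delta x}\Big],$$ and $Q_j(x,t^n)=(\Delta q)^n_j+((\Delta q)_x)^n_j(x-x_j)$ is the reconstruction of $\Delta q(x,t^n)$ on $C_j$. (2) Local speeds and subcells. Let $(q_x)^n_j$ be the slopes of $q^n$ (defined by the same limiter), $q^-_{j+\frac12}=q^n_j+\frac{\Delta x}{2}(q_x)^n_j$ and $q^+_{j+\frac12}=q^n_{j+1}-\frac{\Delta x}{2}(q_x)^n_{j+1}$. Set $$a^n_{j+\frac12}=\max\Big\{\Lambda\big(\tfrac{\partial f}{\partial q}(q^-_{j+\frac12})\big),\ \Lambda\big(\tfrac{\partial f}{\partial q}(q^+_{j+\frac12})\big)\Big\},$$ where $\Lambda(A)$ denotes the largest absolute value of the eigenvalues of $A$. Define $x^n_{j+\frac12,l}=x_{j+\frac12}-a^n_{j+\frac12}\Delta t$, $x^n_{j+\frac12,r}=x_{j+\frac12}+a^n_{j+\frac12}\Delta t$, $\Delta x^n_{j+\frac12}=2a^n_{j+\frac12}\Delta t$, $\Delta x^n_j=\Delta x-\Delta t(a^n_{j-\frac12}+a^n_{j+\frac12})$, and let $x^n_{j,m}$ be the midpoint of $[x^n_{j-\frac12,r},x^n_{j+\frac12,l}]$. It is assumed that $a^n_{j+\frac12}>0$ and that $\Delta t$ is small enough (CFL condition) that $\Delta x^n_j>0$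 for all $j$, so that all the formulas make sense. Write $\tilde q_{j+\frac12,l}=\tilde q(x^n_{j+\frac12,l})$ and $\tilde q_{j+\frac12,r}=\tilde q(x^n_{j+\frac12,r})$. (3) Midpoint values. Set $$(\Delta q)^n_{j+\frac12,l}=(\Delta q)^n_j+\Delta x((\Delta q)_x)^n_j\big[\tfrac12-\lambda a^n_{j+\frac12}\big],\qquad (\Delta q)^n_{j+\frac12,r}=(\Delta q)^n_{j+1}-\Delta x((\Delta q)_x)^n_{j+1}\big[\tfrac12-\lambda a^n_{j+\frac12}\big],$$ and, for $\ast\in\{l,r\}$, $$(\Delta q)^{n+\frac12}_{j+\frac12,\ast}=(\Delta q)^n_{j+\frac12,\ast}+\tfrac{\Delta t}{2}\Big[-\big[(f(\Delta q+\tilde q)-f(\tilde q))_x\big]_{(x^n_{j+\frac12,\ast},t^n)}+S\big((\Delta q)^n_{j+\frac12,\ast},x^n_{j+\frac12,\ast}\big)\Big],$$ where in the $x$-derivative $\Delta q(x,t^n)$ is $Q_j(x,t^n)$ if $\ast=l$ and $Q_{j+1}(x,t^n)$ if $\ast=r$. Put $S^{n+\frac12}_{j+\frac12,\ast}=S\big((\Delta q)^{n+\frac12}_{j+\frac12,\ast},x^n_{j+\frac12,\ast}\big)$. (4) Evolution. The intermediate averages are $$\overline w^{n+1}_{j+\frac12}=\frac{(\Delta q)^n_j+(\Delta q)^n_{j+1}}{2}+\frac{\Delta x-\frac{\Delta x^n_{j+1/2}}{2}}{4}\Big[((\Delta q)_x)^n_j-((\Delta q)_x)^n_{j+1}\Big]$$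 $$+\frac{\Delta t}{\Delta x^n_{j+\frac12}}\Big[-f((\Delta q)^{n+\frac12}_{j+\frac12,r}+\tilde q_{j+\frac12,r})+f(\tilde q_{j+\frac12,r})+f((\Delta q)^{n+\frac12}_{j+\frac12,l}+\tilde q_{j+\frac12,l})-f(\tilde q_{j+\frac12,l})\Big]+\Delta t\,\frac{S^{n+\frac12}_{j+\frac12,l}+S^{n+\frac12}_{j+\frac12,r}}{2},$$ $$\overline w^{n+1}_j=(\Delta q)^n_j+\frac{\Delta x^n_{j-\frac12}-\Delta x^n_{j+\frac12}}{4}((\Delta q)_x)^n_j$$ $$+\frac{\Delta t}{\Delta x^n_j}\Big[-f((\Delta q)^{n+\frac12}_{j+\frac12,l}+\tilde q_{j+\frac12,l})+f(\tilde q_{j+\frac12,l})+f((\Delta q)^{n+\frac12}_{j-\frac12,r}+\tilde q_{j-\frac12,r})-f(\tilde q_{j-\frac12,r})\Big]+\Delta t\,\frac{S^{n+\frac12}_{j-\frac12,r}+S^{n+\frac12}_{j+\frac12,l}}{2}.$$ (5) Projection. With $$(w_x)^{n+1}_{j+\frac12}=\mathrm{minmod}\Big(\theta\tfrac{\overline w^{n+1}_{j+\frac12}-\overline w^{n+1}_j}{x_{j+\frac12}-x^n_{j,m}},\ \tfrac{\overline w^{n+1}_{j+1}-\overline w^{n+1}_j}{x^n_{j+1,m}-x^n_{j,m}},\ \theta\tfrac{\overline w^{n+1}_{j+1}-\overline w^{n+1}_{j+\frac12}}{x^n_{j+1,m}-x_{j+\frac12}}\Big),$$ the update is $$(\Delta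 q)^{n+1}_j=\frac1{\Delta x}\Big[a^n_{j-\frac12}\Delta t\Big(\overline w^{n+1}_{j-\frac12}+\tfrac{a^n_{j-\frac12}\Delta t}{2}(w_x)^{n+1}_{j-\frac12}\Big)+\big(\Delta x-(a^n_{j-\frac12}+a^n_{j+\frac12})\Delta t\big)\overline w^{n+1}_j+a^n_{j+\frac12}\Delta t\Big(\overline w^{n+1}_{j+\frac12}-\tfrac{a^n_{j+\frac12}\Delta t}{2}(w_x)^{n+1}_{j+\frac12}\Big)\Big].$$ *)

theory Defs
  imports "HOL-Analysis.Analysis"
begin

definition minmod3 :: "real \<Rightarrow> real \<Rightarrow> real \<Rightarrow> real" where
  "minmod3 a b c =
     (if sgn a = sgn b \<and> sgn b = sgn c
      then sgn a * min \<bar>a\<bar> (min \<bar>b\<bar> \<bar>c\<bar>) else 0)"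

definition minmod :: "real ^ 'n \<Rightarrow> real ^ 'n \<Rightarrow> real ^ 'n \<Rightarrow> real ^ 'n" where
  "minmod a b c = (\<chi> i. minmod3 (a $ i) (b $ i) (c $ i))"

(* Eigenvalues are taken over the complex numbers, so that the set below is nonempty
   (and finite) for every real square matrix. For a hyperbolic system they are all real. *)
definition eigenvalues :: "real ^ 'n ^ 'n \<Rightarrow> complex set" where
  "eigenvalues A =
     {z. \<exists>v :: complex ^ 'n. v \<noteq> 0 \<and> (\<chi> i j. complex_of_real (A $ i $ j)) *v v = z *s v}"

definition max_abs_eigenvalue :: "real ^ 'n ^ 'n \<Rightarrow> real" where
  "max_abs_eigenvalue A = Max (cmod ` eigenvalues A)"

(* The locale only fixes the data: flux f, source S, stationary solution qt, an arbitrary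
   grid offset xc0 (the center of cell 0), the cell width dx and the limiter parameter \<theta>.
   Cells are indexed by int. For quantities living on cell interfaces, the index j stands for
   the interface j + 1/2, so that j - 1 stands for j - 1/2. The argument dt is the time step
   t^(n+1) - t^n, the argument q is the grid function q^n, and the argument d stands for a
   grid function to be limited. *)
locale kt_deviation_scheme =
  fixes f :: "real ^ 'n \<Rightarrow> real ^ 'n"
    and S :: "real ^ 'n \<Rightarrow> real \<Rightarrow> real ^ 'n"
    and qt :: "real \<Rightarrow> real ^ 'n"
    and xc0 :: real
    and dx :: real
    and \<theta> :: real
begin

definition center :: "int \<Rightarrow> real" where
  "center j = xc0 + of_int j * dx"

definition iface :: "int \<Rightarrow> real" where
  "iface j = center j + dx / 2"

definition slope :: "(int \<Rightarrow> real ^ 'n) \<Rightarrow> int \<Rightarrow> real ^ 'n" where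
  "slope d j =
     minmod (\<theta> *\<^sub>R ((d (j + 1) - d j) /\<^sub>R dx))
            ((d (j + 1) - d (j - 1)) /\<^sub>R (2 * dx))
            (\<theta> *\<^sub>R ((d j - d (j - 1)) /\<^sub>R dx))"

definition deviation :: "(int \<Rightarrow> real ^ 'n) \<Rightarrow> int \<Rightarrow> real ^ 'n" where
  "deviation q j = q j - qt (center j)"

definition recon :: "(int \<Rightarrow> real ^ 'n) \<Rightarrow> int \<Rightarrow> real \<Rightarrow> real ^ 'n" where
  "recon q j x = deviation q j + (x - center j) *\<^sub>R slope (deviation q) j"

definition q_minus :: "(int \<Rightarrow> real ^ 'n) \<Rightarrow> int \<Rightarrow> real ^ 'n" where
  "q_minus q j = q j + (dx / 2) *\<^sub>R slope q j"

definition q_plus :: "(int \<Rightarrow> real ^ 'n) \<Rightarrow> int \<Rightarrow> real ^ 'n" where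
  "q_plus q j = q (j + 1) - (dx / 2) *\<^sub>R slope q (j + 1)"

definition speed :: "(int \<Rightarrow> real ^ 'n) \<Rightarrow> int \<Rightarrow> real" where
  "speed q j =
     max (max_abs_eigenvalue (jacobian f (at (q_minus q j))))
         (max_abs_eigenvalue (jacobian f (at (q_plus q j))))"

definition x_left :: "real \<Rightarrow> (int \<Rightarrow> real ^ 'n) \<Rightarrow> int \<Rightarrow> real" where
  "x_left dt q j = iface j - speed q j * dt"

definition x_right :: "real \<Rightarrow> (int \<Rightarrow> real ^ 'n) \<Rightarrow> int \<Rightarrow> real" where
  "x_right dt q j = iface j + speed q j * dt"

definition iface_width :: "real \<Rightarrow> (int \<Rightarrow> real ^ 'n) \<Rightarrow> int \<Rightarrow> real" where
  "iface_width dt q j = 2 * speed q j * dt"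

definition cell_width :: "real \<Rightarrow> (int \<Rightarrow> real ^ 'n) \<Rightarrow> int \<Rightarrow> real" where
  "cell_width dt q j = dx - dt * (speed q (j - 1) + speed q j)"

definition x_mid :: "real \<Rightarrow> (int \<Rightarrow> real ^ 'n) \<Rightarrow> int \<Rightarrow> real" where
  "x_mid dt q j = (x_right dt q (j - 1) + x_left dt q j) / 2"

definition dev_left :: "real \<Rightarrow> (int \<Rightarrow> real ^ 'n) \<Rightarrow> int \<Rightarrow> real ^ 'n" where
  "dev_left dt q j =
     deviation q j + (dx * (1 / 2 - dt / dx * speed q j)) *\<^sub>R slope (deviation q) j"

definition dev_right :: "real \<Rightarrow> (int \<Rightarrow> real ^ 'n) \<Rightarrow> int \<Rightarrow> real ^ 'n" where
  "dev_right dt q j =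
     deviation q (j + 1) - (dx * (1 / 2 - dt / dx * speed q j)) *\<^sub>R slope (deviation q) (j + 1)"

(* The x-derivative of f (Q_i + qt) - f (qt), with Q_i the reconstruction on cell i. *)
definition flux_diff_deriv :: "(int \<Rightarrow> real ^ 'n) \<Rightarrow> int \<Rightarrow> real \<Rightarrow> real ^ 'n" where
  "flux_diff_deriv q i x = vector_derivative (\<lambda>y. f (recon q i y + qt y) - f (qt y)) (at x)"

definition half_left :: "real \<Rightarrow> (int \<Rightarrow> real ^ 'n) \<Rightarrow> int \<Rightarrow> real ^ 'n" where
  "half_left dt q j =
     dev_left dt q j + (dt / 2) *\<^sub>R
       (- flux_diff_deriv q j (x_left dt q j) + S (dev_left dt q j) (x_left dt q j))"

definition half_right :: "real \<Rightarrow> (int \<Rightarrow> real ^ 'n) \<Rightarrow> int \<Rightarrow> real ^ 'n" where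
  "half_right dt q j =
     dev_right dt q j + (dt / 2) *\<^sub>R
       (- flux_diff_deriv q (j + 1) (x_right dt q j) + S (dev_right dt q j) (x_right dt q j))"

definition source_left :: "real \<Rightarrow> (int \<Rightarrow> real ^ 'n) \<Rightarrow> int \<Rightarrow> real ^ 'n" where
  "source_left dt q j = S (half_left dt q j) (x_left dt q j)"

definition source_right :: "real \<Rightarrow> (int \<Rightarrow> real ^ 'n) \<Rightarrow> int \<Rightarrow> real ^ 'n" where
  "source_right dt q j = S (half_right dt q j) (x_right dt q j)"

definition w_iface :: "real \<Rightarrow> (int \<Rightarrow> real ^ 'n) \<Rightarrow> int \<Rightarrow> real ^ 'n" where
  "w_iface dt q j =
     (deviation q j + deviation q (j + 1)) /\<^sub>R 2
     + ((dx - iface_width dt q j / 2) / 4) *\<^sub>R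
         (slope (deviation q) j - slope (deviation q) (j + 1))
     + (dt / iface_width dt q j) *\<^sub>R
         (- f (half_right dt q j + qt (x_right dt q j)) + f (qt (x_right dt q j))
          + f (half_left dt q j + qt (x_left dt q j)) - f (qt (x_left dt q j)))
     + dt *\<^sub>R ((source_left dt q j + source_right dt q j) /\<^sub>R 2)"

definition w_cell :: "real \<Rightarrow> (int \<Rightarrow> real ^ 'n) \<Rightarrow> int \<Rightarrow> real ^ 'n" where
  "w_cell dt q j =
     deviation q j
     + ((iface_width dt q (j - 1) - iface_width dt q j) / 4) *\<^sub>R slope (deviation q) j
     + (dt / cell_width dt q j) *\<^sub>R
         (- f (half_left dt q j + qt (x_left dt q j)) + f (qt (x_left dt q j))
          + f (half_right dt q (j - 1) + qt (x_right dt q (j - 1)))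
          - f (qt (x_right dt q (j - 1))))
     + dt *\<^sub>R ((source_right dt q (j - 1) + source_left dt q j) /\<^sub>R 2)"

definition w_slope :: "real \<Rightarrow> (int \<Rightarrow> real ^ 'n) \<Rightarrow> int \<Rightarrow> real ^ 'n" where
  "w_slope dt q j =
     minmod (\<theta> *\<^sub>R ((w_iface dt q j - w_cell dt q j) /\<^sub>R (iface j - x_mid dt q j)))
            ((w_cell dt q (j + 1) - w_cell dt q j) /\<^sub>R (x_mid dt q (j + 1) - x_mid dt q j))
            (\<theta> *\<^sub>R ((w_cell dt q (j + 1) - w_iface dt q j) /\<^sub>R (x_mid dt q (j + 1) - iface j)))"

definition next_deviation :: "real \<Rightarrow> (int \<Rightarrow> real ^ 'n) \<Rightarrow> int \<Rightarrow> real ^ 'n" where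
  "next_deviation dt q j =
     ((speed q (j - 1) * dt) *\<^sub>R
        (w_iface dt q (j - 1) + (speed q (j - 1) * dt / 2) *\<^sub>R w_slope dt q (j - 1))
      + (dx - (speed q (j - 1) + speed q j) * dt) *\<^sub>R w_cell dt q j
      + (speed q j * dt) *\<^sub>R
        (w_iface dt q j - (speed q j * dt / 2) *\<^sub>R w_slope dt q j)) /\<^sub>R dx"

definition step :: "real \<Rightarrow> (int \<Rightarrow> real ^ 'n) \<Rightarrow> int \<Rightarrow> real ^ 'n" where
  "step dt q j = next_deviation dt q j + qt (center j)"

end

end

theory Submission
  imports Defs
begin

text \<open>
  On the stationary grid function the deviation vanishes identically, so every difference
  \<open>f (\<Delta>q + qt) - f qt\<close> cancels and every source term is \<open>S 0 x = 0\<close> by linearity. Hence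
  one step produces zero deviation again, whatever the local speeds are.
\<close>

lemma minmod_zero [simp]: "minmod 0 0 0 = 0"
  by (simp add: minmod_def minmod3_def vec_eq_iff)

context kt_deviation_scheme
begin

lemma slope_eq_0:
  assumes "\<And>i. d i = 0"
  shows "slope d j = 0"
  by (simp add: slope_def assms)

lemma step_equilibrium:
  assumes S_0: "\<And>x. S 0 x = 0"
    and equilibrium: "\<And>j. q j = qt (center j)"
  shows "step dt q j = qt (center j)"
proof -
  have dev: "deviation q i = 0" for i
    by (simp add: deviation_def equilibrium)
  have slope: "slope (deviation q) i = 0" for i
    by (rule slope_eq_0) (rule dev)
  \<comment> \<open>The reconstruction is zero at every point, so the function being differentiated
    is constantly 0 and not just zero at \<open>x\<close>.\<close>
  have flux: "flux_diff_deriv q i x = 0" for i x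
    by (simp add: flux_diff_deriv_def recon_def dev slope)
  have half: "half_left dt q i = 0" "half_right dt q i = 0" for i
    by (simp_all add: half_left_def half_right_def dev_left_def dev_right_def dev slope flux S_0)
  \<comment> \<open>At each subcell endpoint the two flux values coincide, so the quotients by the
    subcell widths multiply a zero vector.\<close>
  have w: "w_iface dt q i = 0" "w_cell dt q i = 0" for i
    by (simp_all add: w_iface_def w_cell_def source_left_def source_right_def half dev slope S_0)
  show ?thesis
    by (simp add: step_def next_deviation_def w_slope_def w)
qed

end

theorem mainTheorem1:
  fixes f :: "real ^ 'n \<Rightarrow> real ^ 'n"
    and S :: "real ^ 'n \<Rightarrow> real \<Rightarrow> real ^ 'n"
    and qt :: "real \<Rightarrow> real ^ 'n"
    and xc0 dx \<theta> :: real
    and dt :: "nat \<Rightarrow> real"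
    and q :: "nat \<Rightarrow> int \<Rightarrow> real ^ 'n"
  assumes "dx > 0" and "\<And>n. dt n > 0" and "1 \<le> \<theta>" and "\<theta> \<le> 2"
    and f_differentiable: "\<And>u. f differentiable (at u)"
    and S_linear: "\<And>x. linear (\<lambda>u. S u x)"
    and qt_differentiable: "\<And>x. qt differentiable (at x)"
    and qt_stationary: "\<And>x. ((\<lambda>y. f (qt y)) has_vector_derivative S (qt x) x) (at x)"
    and speed_pos: "\<And>n j. kt_deviation_scheme.speed f dx \<theta> (q n) j > 0"
    and CFL: "\<And>n j. kt_deviation_scheme.cell_width f dx \<theta> (dt n) (q n) j > 0"
    and scheme: "\<And>n j. q (Suc n) j = kt_deviation_scheme.step f S qt xc0 dx \<theta> (dt n) (q n) j"
    and initial: "\<And>j. q 0 j = qt (kt_deviation_scheme.center xc0 dx j)"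
  shows "\<forall>n j. q n j = qt (kt_deviation_scheme.center xc0 dx j)"
proof
  fix n
  interpret kt_deviation_scheme f S qt xc0 dx \<theta> .
  have S_0: "S 0 x = 0" for x
    using linear_0[OF S_linear] .
  \<comment> \<open>The induction carries all cells at once, because a step at cell \<open>j\<close>
    also reads the values in neighbouring cells.\<close>
  show "\<forall>j. q n j = qt (center j)"
  proof (induction n)
    case 0
    show ?case by (simp add: initial)
  next
    case (Suc n)
    then show ?case by (simp add: scheme step_equilibrium S_0)
  qed
qed

end
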